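(* Let $n\ge3$, $\ell\ge3$, $m\ge1$ be integers, $N=n(m\ell-1)$ and $\ell\le s\le N-\ell$. Then: (i) For $0\le i\le E(s)-E(s)_0$, $$\#\mathcal K_i^{(s)}=\sum_{j=0}^{\lfloor\frac{E(s)_0+i}{m}\rfloor}(-1)^j\binom nj\binom{n+(E(s)_0+i)-jm-1}{n-1}.$$ (ii) $$\sum_{i=0}^{\lfloor\frac{s}{m\ell}\rfloor}(-1)^i\binom ni\binom{n+s-im\ell-1}{n-1}=\sum_{i=0}^{E(s)-E(s)_0}\Bigl(\sum_{j=0}^{\lfloor\frac{s_i}{\ell}\rfloor}(-1)^j\binom nj\binom{n+s_i-j\ell-1}{n-1}\Bigr)\Bigl(\sum_{j=0}^{\lfloor\frac{E(s)_0+i}{m}\rfloor}(-1)^j\binom nj\binom{n+(E(s)_0+i)-jm-1}{n-1}\Bigr),$$ where $s_i$ is defined by $s=(E(s)_0+i)\ell+s_i$.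
   Context: For $\alpha\in\mathbb Z_{\ge0}^n$ put $|\alpha|=\sum_j\alpha_j$ and $\mathrm{Edeg}(\alpha)=\sum_{j=1}^n\lfloor\alpha_j/\ell\rfloor$. $E(s)_0$ (resp. $E(s)$) is the minimum (resp. maximum) of $\mathrm{Edeg}(\alpha)$ over all $\alpha\in\mathbb Z_{\ge0}^n$ with $|\alpha|=s$ and $\alpha_j\le m\ell-1$ for all $j$. For $0\le i\le E(s)-E(s)_0$, $\mathcal K_i^{(s)}=\{\underline\kappa=(\kappa_1,\dots,\kappa_n)\in\mathbb Z_{\ge0}^n\mid|\underline\kappa|=E(s)_0+i,\ \kappa_j\le m-1\ \forall j\}$. All binomial coefficients are ordinary. *)

theory Defs
  imports Complex_Main
begin

text \<open>Elements of \<open>\<int>\<^sub>\<ge>\<^sub>0\<^sup>n\<close> are encoded as lists of naturals of length \<open>n\<close>;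
  the (1-based) component \<open>\<alpha>\<^sub>j\<close> is \<open>\<alpha> ! (j - 1)\<close>.\<close>

definition Edeg :: "nat \<Rightarrow> nat list \<Rightarrow> nat" where
  "Edeg l \<alpha> = (\<Sum>j<length \<alpha>. (\<alpha> ! j) div l)"

definition bounded_exps :: "nat \<Rightarrow> nat \<Rightarrow> nat \<Rightarrow> nat list set" where
  "bounded_exps n b s = {\<alpha>. length \<alpha> = n \<and> (\<Sum>j<n. \<alpha> ! j) = s \<and> (\<forall>j<n. \<alpha> ! j \<le> b)}"

definition Emin :: "nat \<Rightarrow> nat \<Rightarrow> nat \<Rightarrow> nat \<Rightarrow> nat" where
  "Emin n l m s = Min (Edeg l ` bounded_exps n (m * l - 1) s)"

definition Emax :: "nat \<Rightarrow> nat \<Rightarrow> nat \<Rightarrow> nat \<Rightarrow> nat" where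
  "Emax n l m s = Max (Edeg l ` bounded_exps n (m * l - 1) s)"

definition Kset :: "nat \<Rightarrow> nat \<Rightarrow> nat \<Rightarrow> nat \<Rightarrow> nat \<Rightarrow> nat list set" where
  "Kset n l m s i = bounded_exps n (m - 1) (Emin n l m s + i)"

text \<open>The number \<open>s\<^sub>i\<close> with \<open>s = (E(s)\<^sub>0 + i) l + s\<^sub>i\<close>. The subtraction does not truncate for
  \<open>i \<le> E(s) - E(s)\<^sub>0\<close>; see lemma \<open>srem_eq\<close> below.\<close>

definition srem :: "nat \<Rightarrow> nat \<Rightarrow> nat \<Rightarrow> nat \<Rightarrow> nat \<Rightarrow> nat" where
  "srem n l m s i = s - (Emin n l m s + i) * l"

lemma finite_bounded_exps: "finite (bounded_exps n b s)"
proof (rule finite_subset)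
  show "bounded_exps n b s \<subseteq> {xs. set xs \<subseteq> {..b} \<and> length xs = n}"
    by (fastforce simp: bounded_exps_def in_set_conv_nth)
  show "finite {xs. set xs \<subseteq> {..b} \<and> length xs = n}"
    by (rule finite_lists_length_eq) simp
qed

lemma bounded_exps_nonempty: "s \<le> n * b \<Longrightarrow> bounded_exps n b s \<noteq> {}"
proof (induction n arbitrary: s)
  case 0
  then show ?case by (auto simp: bounded_exps_def)
next
  case (Suc n)
  have "s - min s b \<le> n * b" using Suc.prems by (cases "s \<le> b") simp_all
  from Suc.IH[OF this] obtain \<alpha> where "\<alpha> \<in> bounded_exps n b (s - min s b)" by blast
  then have "min s b # \<alpha> \<in> bounded_exps (Suc n) b s"
    by (simp add: bounded_exps_def sum.lessThan_Suc_shift All_less_Suc2 del: sum.lessThan_Suc)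
  then show ?case by blast
qed

lemma srem_eq:
  assumes "s \<le> n * (m * l - 1)" and "i \<le> Emax n l m s - Emin n l m s"
  shows "s = (Emin n l m s + i) * l + srem n l m s i"
proof -
  let ?A = "Edeg l ` bounded_exps n (m * l - 1) s"
  have fin: "finite ?A" and ne: "?A \<noteq> {}"
    using finite_bounded_exps bounded_exps_nonempty[OF assms(1)] by auto
  have "Emin n l m s \<le> Emax n l m s"
    unfolding Emin_def Emax_def using fin ne by (meson Max_in Min_le)
  then have 1: "Emin n l m s + i \<le> Emax n l m s" using assms(2) by simp
  obtain \<alpha> where \<alpha>: "\<alpha> \<in> bounded_exps n (m * l - 1) s" "Emax n l m s = Edeg l \<alpha>"
    unfolding Emax_def using Max_in[OF fin ne] by auto
  have "Edeg l \<alpha> * l = (\<Sum>j<n. (\<alpha> ! j) div l * l)"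
    using \<alpha>(1) by (simp add: Edeg_def bounded_exps_def sum_distrib_right)
  also have "\<dots> \<le> (\<Sum>j<n. \<alpha> ! j)" by (rule sum_mono) simp
  also have "\<dots> = s" using \<alpha>(1) by (simp add: bounded_exps_def)
  finally have "(Emin n l m s + i) * l \<le> s"
    using 1 \<alpha>(2) by (metis le_trans mult_le_mono1)
  then show ?thesis by (simp add: srem_def)
qed

end

theory Submission
  imports Defs "HOL-Computational_Algebra.Formal_Power_Series"
begin

text \<open>The generating function of the tuples with entries below \<open>k\<close> is
  \<open>(1 + X + \<dots> + X\<^bsup>k-1\<^esup>)\<^sup>n = (1 - X\<^sup>k)\<^sup>n (1 - X)\<^bsup>-n\<^esup>\<close>; expanding both factors gives the alternating
  sums. Part (ii) then counts the \<open>\<alpha>\<close> with \<open>|\<alpha>| = s\<close> by their value of \<open>Edeg\<close>: division with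
  remainder by \<open>l\<close> in every component splits \<open>\<alpha>\<close> uniquely into quotients, which are below \<open>m\<close>
  and sum to \<open>Edeg \<alpha>\<close>, and remainders below \<open>l\<close>.\<close>

lemma bounded_exps_0: "bounded_exps 0 b s = (if s = 0 then {[]} else {})"
  by (auto simp: bounded_exps_def)

text \<open>Recursion on the first entry \<open>x\<close>; the condition \<open>x \<le> s\<close>
  keeps \<open>s - x\<close> from truncating.\<close>

lemma bounded_exps_Suc:
  "bounded_exps (Suc n) b s = (\<Union>x\<in>{x. x \<le> s \<and> x \<le> b}. (#) x ` bounded_exps n b (s - x))"
  (is "?L = ?R")
proof
  show "?L \<subseteq> ?R"
  proof
    fix \<alpha> assume "\<alpha> \<in> ?L"
    then obtain x \<beta> where "\<alpha> = x # \<beta>" "x \<le> s" "x \<le> b" "\<beta> \<in> bounded_exps n b (s - x)"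
      by (cases \<alpha>)
        (auto simp: bounded_exps_def sum.lessThan_Suc_shift All_less_Suc2 simp del: sum.lessThan_Suc)
    then show "\<alpha> \<in> ?R" by blast
  qed
  show "?R \<subseteq> ?L"
    by (auto simp: bounded_exps_def sum.lessThan_Suc_shift All_less_Suc2 simp del: sum.lessThan_Suc)
qed

text \<open>The bound on the first entry becomes a 0/1 factor so that the recursion has the shape of
  a Cauchy product, as needed for the induction on powers of the generating function.\<close>

lemma card_bounded_exps_Suc:
  "card (bounded_exps (Suc n) b s) =
    (\<Sum>x=0..s. (if x \<le> b then 1 else 0) * card (bounded_exps n b (s - x)))"
proof -
  have "card (bounded_exps (Suc n) b s) =
      (\<Sum>x\<in>{x. x \<le> s \<and> x \<le> b}. card ((#) x ` bounded_exps n b (s - x)))"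
    unfolding bounded_exps_Suc
    by (rule card_UN_disjoint) (auto simp: finite_bounded_exps)
  also have "\<dots> = (\<Sum>x\<in>{x. x \<le> s \<and> x \<le> b}. card (bounded_exps n b (s - x)))"
    by (simp add: card_image)
  also have "\<dots> = (\<Sum>x=0..s. (if x \<le> b then 1 else 0) * card (bounded_exps n b (s - x)))"
    by (rule sum.mono_neutral_cong_left) auto
  finally show ?thesis .
qed

lemma fps_nth_bounded_exps:
  "fps_nth (Abs_fps (\<lambda>x. if x \<le> b then 1 else 0) ^ n :: 'a::comm_semiring_1 fps) s =
    of_nat (card (bounded_exps n b s))"
proof (induction n arbitrary: s)
  case 0
  then show ?case by (simp add: bounded_exps_0)
next
  case (Suc n)
  then show ?case
    by (simp add: card_bounded_exps_Suc fps_mult_nth if_distrib[of of_nat] cong: if_cong)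
qed

text \<open>Multiplying by \<open>1 - fps_X\<close> takes differences of consecutive coefficients,
  and these are nonzero only at degree 0 and just past the cut-off, at \<open>Suc b\<close>.\<close>

lemma fps_truncated_geometric:
  "(Abs_fps (\<lambda>x. if x \<le> b then 1 else 0) :: 'a::comm_ring_1 fps) * (1 - fps_X) = 1 - fps_X ^ Suc b"
  by (rule fps_ext) (auto simp: algebra_simps fps_X_power_nth simp del: power_Suc)

text \<open>All alternating sums of the theorem are instances, with \<open>k\<close> equal to
  \<open>m\<close>, \<open>l\<close> or \<open>m * l\<close>. The computation runs over the reals,
  where power series can be inverted, and returns to the integers at the end.\<close>

lemma card_bounded_exps:
  assumes "n > 0" "k > 0"
  shows "int (card (bounded_exps n (k - 1) s)) =
    (\<Sum>j=0..s div k. (-1) ^ j * int (n choose j) * int ((n + s - j * k - 1) choose (n - 1)))"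
proof -
  let ?g = "Abs_fps (\<lambda>x. if x \<le> k - 1 then 1 else 0) :: real fps"
  let ?h = "Abs_fps (\<lambda>i. of_nat ((n + i - 1) choose i)) :: real fps"
  \<comment> \<open>Negative binomial series.\<close>
  have inv: "inverse ((1 - fps_X) ^ n) = ?h"
    using one_minus_const_fps_X_neg_power'[OF assms(1), of "1::real"] by simp
  have unit: "(1 - fps_X :: real fps) ^ n * ?h = 1"
    unfolding inv[symmetric] by (rule inverse_mult_eq_1') simp
  have "?g ^ n = (?g * (1 - fps_X)) ^ n * ?h"
    using unit by (simp add: power_mult_distrib mult.assoc)
  also have "?g * (1 - fps_X) = 1 - fps_X ^ k"
    using fps_truncated_geometric[of "k - 1", where 'a = real] assms(2) by simp
  also have "(1 - fps_X ^ k :: real fps) ^ n =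
      (\<Sum>j\<le>n. fps_const ((-1) ^ j * of_nat (n choose j)) * fps_X ^ (j * k))"
  proof -
    have "(1 - fps_X ^ k :: real fps) ^ n = (- (fps_X ^ k) + 1) ^ n" by simp
    also have "\<dots> = (\<Sum>j\<le>n. of_nat (n choose j) * (- (fps_X ^ k)) ^ j)"
      by (subst binomial_ring) simp
    also have "\<dots> = (\<Sum>j\<le>n. fps_const ((-1) ^ j * of_nat (n choose j)) * fps_X ^ (j * k))"
    proof (rule sum.cong[OF refl])
      fix j
      have "(- (fps_X ^ k) :: real fps) ^ j = fps_const ((-1) ^ j) * fps_X ^ (j * k)"
        by (subst power_minus)
          (simp add: power_mult [symmetric] mult.commute fps_const_power [symmetric]
            fps_const_neg [symmetric] del: fps_const_neg fps_const_power)
      then show "of_nat (n choose j) * (- (fps_X ^ k) :: real fps) ^ j =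
          fps_const ((-1) ^ j * of_nat (n choose j)) * fps_X ^ (j * k)"
        by (simp add: fps_of_nat [symmetric] fps_const_mult [symmetric] mult_ac del: fps_const_mult)
    qed
    finally show ?thesis .
  qed
  finally have "real (card (bounded_exps n (k - 1) s)) =
      fps_nth ((\<Sum>j\<le>n. fps_const ((-1) ^ j * of_nat (n choose j)) * fps_X ^ (j * k)) * ?h) s"
    by (simp only: fps_nth_bounded_exps [symmetric])
  also have "\<dots> = (\<Sum>j\<le>n. (-1) ^ j * of_nat (n choose j) *
      (if s < j * k then 0 else of_nat ((n + (s - j * k) - 1) choose (s - j * k))))"
    by (simp add: sum_distrib_right fps_sum_nth mult.assoc fps_X_power_mult_nth cong: if_cong)
  also have "\<dots> = (\<Sum>j=0..s div k. (-1) ^ j * of_nat (n choose j) *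
      of_nat ((n + s - j * k - 1) choose (n - 1)))"
  \<comment> \<open>The two index ranges may differ in either direction: for \<open>j > n\<close>
    the factor \<open>n choose j\<close> vanishes, and for \<open>j > s div k\<close> the shift by
    \<open>j * k\<close> exceeds \<open>s\<close>, so the coefficient is 0.\<close>
  proof (rule sum.mono_neutral_cong)
    fix j assume "j \<in> {..n} \<inter> {0..s div k}"
    then have le: "j * k \<le> s"
      using assms(2) by (simp add: less_eq_div_iff_mult_less_eq)
    \<comment> \<open>Symmetry of binomial coefficients; the lower indices add up to the upper one
      because \<open>n > 0\<close>.\<close>
    have "(n + (s - j * k) - 1) choose (s - j * k) = (n + s - j * k - 1) choose (n - 1)"
      using le assms(1) binomial_symmetric[of "s - j * k" "n + (s - j * k) - 1"] by simp
    then show "(-1) ^ j * real (n choose j) *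
        (if s < j * k then 0 else real ((n + (s - j * k) - 1) choose (s - j * k))) =
        (-1) ^ j * real (n choose j) * real ((n + s - j * k - 1) choose (n - 1))"
      using le by simp
  qed (use assms(2) in \<open>auto simp: less_eq_div_iff_mult_less_eq not_le\<close>)
  finally have "of_int (int (card (bounded_exps n (k - 1) s))) = (of_int
      (\<Sum>j=0..s div k. (-1) ^ j * int (n choose j) * int ((n + s - j * k - 1) choose (n - 1))) :: real)"
    by simp
  then show ?thesis by (simp only: of_int_eq_iff)
qed

lemma le_pred_mult_iff_div:
  fixes x l m :: nat
  assumes "l > 0" "m > 0"
  shows "x \<le> m * l - 1 \<longleftrightarrow> x div l \<le> m - 1"
proof -
  have "x \<le> m * l - 1 \<longleftrightarrow> x < m * l" using assms by (cases "m * l") auto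
  also have "\<dots> \<longleftrightarrow> x div l < m" using assms by (simp add: div_less_iff_less_mult)
  also have "\<dots> \<longleftrightarrow> x div l \<le> m - 1" using assms by auto
  finally show ?thesis .
qed

text \<open>Once the quotients sum to \<open>E\<close>, the remainders must sum to
  \<open>s - E * l\<close>, and the two lists can be chosen independently. If \<open>E * l\<close>
  exceeded \<open>s\<close>, the fibre would be empty while the truncated difference 0 would still
  admit the zero list of remainders.\<close>

lemma card_bounded_exps_Edeg:
  assumes l: "l > 0" and m: "m > 0" and E: "E * l \<le> s"
  shows "card {\<alpha> \<in> bounded_exps n (m * l - 1) s. Edeg l \<alpha> = E} =
    card (bounded_exps n (m - 1) E) * card (bounded_exps n (l - 1) (s - E * l))"
proof -
  let ?f = "\<lambda>\<alpha>. (map (\<lambda>x. x div l) \<alpha>, map (\<lambda>x. x mod l) \<alpha>)"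
  let ?g = "\<lambda>(\<kappa>, \<rho>). map2 (\<lambda>q r. q * l + r) \<kappa> \<rho>"
  let ?A = "{\<alpha> \<in> bounded_exps n (m * l - 1) s. Edeg l \<alpha> = E}"
  let ?B = "bounded_exps n (m - 1) E \<times> bounded_exps n (l - 1) (s - E * l)"
  have rem_less: "\<rho> ! j < l" if "\<rho> \<in> bounded_exps n (l - 1) t" "j < n" for \<rho> t j
  proof -
    have "\<rho> ! j \<le> l - 1" using that by (simp add: bounded_exps_def)
    then show ?thesis using l by linarith
  qed
  have "bij_betw ?f ?A ?B"
  proof (rule bij_betw_byWitness[where f' = ?g])
    show "\<forall>\<alpha>\<in>?A. ?g (?f \<alpha>) = \<alpha>"
      by (auto intro!: nth_equalityI)
    show "\<forall>p\<in>?B. ?f (?g p) = p"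
    proof (rule ballI)
      fix p assume "p \<in> ?B"
      then obtain \<kappa> \<rho> where p: "p = (\<kappa>, \<rho>)" and k: "\<kappa> \<in> bounded_exps n (m - 1) E"
        and r: "\<rho> \<in> bounded_exps n (l - 1) (s - E * l)"
        by blast
      \<comment> \<open>Remainders below \<open>l\<close> ensure that division by \<open>l\<close>
        recovers both lists from \<open>q * l + r\<close>.\<close>
      note rem_less[OF r]
      then show "?f (?g p) = p"
        using p k r l by (auto simp: bounded_exps_def intro!: nth_equalityI)
    qed
    show "?f ` ?A \<subseteq> ?B"
    proof (rule image_subsetI)
      fix \<alpha> assume a: "\<alpha> \<in> ?A"
      \<comment> \<open>Division with remainder, summed over all components.\<close>
      have "s = (\<Sum>j<n. \<alpha> ! j div l * l + \<alpha> ! j mod l)"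
        using a by (simp add: bounded_exps_def)
      also have "\<dots> = E * l + (\<Sum>j<n. \<alpha> ! j mod l)"
        using a by (auto simp only: bounded_exps_def Edeg_def sum.distrib sum_distrib_right)
      finally have "(\<Sum>j<n. \<alpha> ! j mod l) = s - E * l" by simp
      moreover have "x mod l \<le> l - 1" for x using l mod_less_divisor[of l x] by linarith
      ultimately show "?f \<alpha> \<in> ?B"
        using a by (auto simp: bounded_exps_def Edeg_def
            le_pred_mult_iff_div[OF l m, unfolded One_nat_def])
    qed
    show "?g ` ?B \<subseteq> ?A"
    proof (rule image_subsetI)
      fix p assume "p \<in> ?B"
      then obtain \<kappa> \<rho> where p: "p = (\<kappa>, \<rho>)" and k: "\<kappa> \<in> bounded_exps n (m - 1) E"
        and r: "\<rho> \<in> bounded_exps n (l - 1) (s - E * l)"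
        by blast
      note rem_less[OF r]
      then show "?g p \<in> ?A"
        using p k r l E
        by (auto simp: bounded_exps_def Edeg_def sum.distrib sum_distrib_right [symmetric]
            le_pred_mult_iff_div[OF l m, unfolded One_nat_def])
    qed
  qed
  then show ?thesis
    by (simp add: bij_betw_same_card card_cartesian_product)
qed

theorem corollary3p11:
  fixes n l m s N :: nat
  assumes "n \<ge> 3" and "l \<ge> 3" and "m \<ge> 1"
    and "N = n * (m * l - 1)"
    and "l \<le> s" and "s \<le> N - l"
  shows "(\<forall>i \<le> Emax n l m s - Emin n l m s.
            int (card (Kset n l m s i)) =
              (\<Sum>j = 0..(Emin n l m s + i) div m.
                 (-1) ^ j * int (n choose j) * int ((n + (Emin n l m s + i) - j * m - 1) choose (n - 1))))
       \<and> (\<Sum>i = 0..s div (m * l).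
            (-1) ^ i * int (n choose i) * int ((n + s - i * m * l - 1) choose (n - 1))) =
         (\<Sum>i = 0..Emax n l m s - Emin n l m s.
            (\<Sum>j = 0..srem n l m s i div l.
               (-1) ^ j * int (n choose j) * int ((n + srem n l m s i - j * l - 1) choose (n - 1))) *
            (\<Sum>j = 0..(Emin n l m s + i) div m.
               (-1) ^ j * int (n choose j) * int ((n + (Emin n l m s + i) - j * m - 1) choose (n - 1))))"
proof (intro conjI allI impI)
  have pos: "n > 0" "m > 0" using assms(1,3) by auto
  fix i
  let ?lo = "Emin n l m s"
  show "int (card (Kset n l m s i)) =
      (\<Sum>j = 0..(?lo + i) div m.
        (-1) ^ j * int (n choose j) * int ((n + (?lo + i) - j * m - 1) choose (n - 1)))"
    unfolding Kset_def by (rule card_bounded_exps[OF pos])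
next
  have pos: "n > 0" "l > 0" "m > 0" using assms(1-3) by auto
  let ?B = "bounded_exps n (m * l - 1) s"
  let ?lo = "Emin n l m s" and ?hi = "Emax n l m s"
  \<comment> \<open>This makes \<open>?B\<close> nonempty, so that \<open>Min\<close> and
    \<open>Max\<close> in the definitions of \<open>Emin\<close> and \<open>Emax\<close> are
    attained.\<close>
  have s: "s \<le> n * (m * l - 1)" using assms(4,6) by simp
  have fin: "finite (Edeg l ` ?B)" and ne: "?B \<noteq> {}"
    using finite_bounded_exps bounded_exps_nonempty[OF s] by auto
  have lohi: "?lo \<le> ?hi"
    unfolding Emin_def Emax_def using fin ne by (meson Max_in Min_le image_is_empty)
  have range: "Edeg l ` ?B \<subseteq> {?lo..?hi}"
    unfolding Emin_def Emax_def using fin by auto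
  have fibre: "card {\<alpha> \<in> ?B. Edeg l \<alpha> = ?lo + i} =
      card (bounded_exps n (l - 1) (srem n l m s i)) * card (bounded_exps n (m - 1) (?lo + i))"
    if "i \<le> ?hi - ?lo" for i
  proof -
    have "(?lo + i) * l \<le> s" using srem_eq[OF s that] by linarith
    then show ?thesis
      unfolding srem_def using card_bounded_exps_Edeg[OF pos(2,3)] by (simp only: mult.commute)
  qed
  \<comment> \<open>Partition of \<open>?B\<close> into the fibres of \<open>Edeg l\<close>; a value
    in the interval that is not attained would contribute an empty fibre.\<close>
  have "card ?B = (\<Sum>E\<in>{?lo..?hi}. card {\<alpha> \<in> ?B. Edeg l \<alpha> = E})"
    using sum.group[OF finite_bounded_exps _ range, of "\<lambda>_. 1::nat"] by simp
  also have "\<dots> = (\<Sum>i=0..?hi - ?lo. card {\<alpha> \<in> ?B. Edeg l \<alpha> = ?lo + i})"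
    by (rule sum.reindex_bij_witness[where i = "\<lambda>i. ?lo + i" and j = "\<lambda>E. E - ?lo"])
      (use lohi in auto)
  also have "\<dots> = (\<Sum>i=0..?hi - ?lo.
      card (bounded_exps n (l - 1) (srem n l m s i)) * card (bounded_exps n (m - 1) (?lo + i)))"
    by (rule sum.cong[OF refl], rule fibre) simp
  finally have "int (card ?B) = (\<Sum>i=0..?hi - ?lo.
      int (card (bounded_exps n (l - 1) (srem n l m s i))) *
      int (card (bounded_exps n (m - 1) (?lo + i))))"
    by simp
  moreover have "m * l > 0" using pos by simp
  \<comment> \<open>Each of the three cardinalities is replaced by its alternating sum;
    associativity turns \<open>i * m * l\<close> into \<open>i * (m * l)\<close> for the case
    \<open>k = m * l\<close>.\<close>
  ultimately show "(\<Sum>i = 0..s div (m * l).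
        (-1) ^ i * int (n choose i) * int ((n + s - i * m * l - 1) choose (n - 1))) =
      (\<Sum>i = 0..?hi - ?lo.
        (\<Sum>j = 0..srem n l m s i div l.
          (-1) ^ j * int (n choose j) * int ((n + srem n l m s i - j * l - 1) choose (n - 1))) *
        (\<Sum>j = 0..(?lo + i) div m.
          (-1) ^ j * int (n choose j) * int ((n + (?lo + i) - j * m - 1) choose (n - 1))))"
    by (simp only: card_bounded_exps pos mult.assoc)
qed

end
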